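(* Let $\mathbf p=(p,X,Y)$ be a bivincular pattern of rank $r$ (i.e. $p\in\mathfrak S_r$) such that $r\in Y$. Then for every $n$ the map $\pi\mapsto\pi\oplus1$ is a bijection $\mathfrak A_n(\mathbf p)\to\mathfrak A_n(\mathbf p\oplus1)$, and, with respect to toric equivalence, $\widetilde{\mathfrak A}_n(\mathbf p)=\widetilde{\mathfrak A}_n(\mathbf p\oplus1)$.
   Context: A bivincular pattern is a triple $(p,X,Y)$ with $p\in\mathfrak S_r$ and $X,Y\subseteq\{0,1,\dots,r\}$. An occurrence of $(p,X,Y)$ in $\pi=\pi_1\cdots\pi_n\in\mathfrak S_n$ is a subsequence $\pi_{i_1}\cdots\pi_{i_r}$ ($i_1<\cdots<i_r$) whose letters are in the same relative order as the letters of $p$, such that $i_{x+1}=i_x+1$ for all $x\in X$, and $j_{y+1}=j_y+1$ for all $y\in Y$, where $\{\pi_{i_1},\dots,\pi_{i_r}\}=\{j_1<\cdots<j_r\}$ and by convention $i_0=j_0=0$, $i_{r+1}=j_{r+1}=n+1$. A permutation avoids a pattern if it has no occurrence of it. $\mathfrak A_n(\mathbf p)$ is the set of permutations in $\mathfrak S_n$ avoiding $\mathbf p$. For $\pi\in\mathfrak S_n$ and an integer $m$, the permutation $\pi\oplus m\in\mathfrak S_n$ is defined as follows: form the circular word $0\,\pi_1\pi_2\cdots\pi_n$ on $\{0,\dots,n\}$, add $m$ modulo $n+1$ to every letter, and read the resulting circular word starting just after the letter $0$. The toric class of $\pi$ is $\{\pi\oplus m: m=0,1,\dots,n\}$, and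 two permutations are torically equivalent if they are in the same toric class. $\widetilde{\mathfrak A}_n(\mathbf p)$ is the set of $\pi\in\mathfrak S_n$ such that $\pi$ and every permutation torically equivalent to $\pi$ avoids $\mathbf p$. For a pattern $\mathbf p=(p,X,Y)$ of rank $r$ whose letter $r$ is at position $\ell$ in $p$, define $\mathbf p\oplus1=(p\oplus1,\;X\ominus\ell,\;Y\oplus1)$, where $X\ominus\ell=\{x-\ell \bmod (r+1): x\in X\}$ and $Y\oplus 1=\{y+1\bmod (r+1): y\in Y\}$. *)

theory Defs
  imports "HOL-Combinatorics.Permutations"
begin

text \<open>A permutation of rank \<open>n\<close> is a function \<open>\<pi>\<close> with \<open>\<pi> permutes {1..n}\<close>; its \<open>i\<close>-th letter is
  \<open>\<pi> i\<close>. Since \<open>\<pi> 0 = 0\<close>, the word \<open>0 \<pi>\<^sub>1 \<dots> \<pi>\<^sub>n\<close> is \<open>\<pi>\<close> read on the positions \<open>0..n\<close>. As the function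
  does not determine its rank, ranks are explicit arguments throughout.\<close>

subsection \<open>Bivincular patterns\<close>

type_synonym bivincular = "(nat \<Rightarrow> nat) \<times> nat set \<times> nat set"

fun bivincular_pattern :: "nat \<Rightarrow> bivincular \<Rightarrow> bool" where
  "bivincular_pattern r (p, X, Y) \<longleftrightarrow> p permutes {1..r} \<and> X \<subseteq> {0..r} \<and> Y \<subseteq> {0..r}"

text \<open>\<open>i\<close> lists the positions of the occurrence and \<open>j\<close> its values in increasing order, both
  extended to the indices \<open>0\<close> and \<open>r + 1\<close>.\<close>

fun occurrence :: "nat \<Rightarrow> bivincular \<Rightarrow> nat \<Rightarrow> (nat \<Rightarrow> nat) \<Rightarrow> (nat \<Rightarrow> nat) \<Rightarrow> bool" where
  "occurrence r (p, X, Y) n \<pi> i \<longleftrightarrow>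
     i ` {1..r} \<subseteq> {1..n} \<and> strict_mono_on {1..r} i \<and> i 0 = 0 \<and> i (r + 1) = n + 1 \<and>
     (\<forall>a\<in>{1..r}. \<forall>b\<in>{1..r}. \<pi> (i a) < \<pi> (i b) \<longleftrightarrow> p a < p b) \<and>
     (\<forall>x\<in>X. i (x + 1) = i x + 1) \<and>
     (\<exists>j. j ` {1..r} = (\<lambda>a. \<pi> (i a)) ` {1..r} \<and> strict_mono_on {1..r} j \<and>
          j 0 = 0 \<and> j (r + 1) = n + 1 \<and> (\<forall>y\<in>Y. j (y + 1) = j y + 1))"

definition avoids :: "nat \<Rightarrow> (nat \<Rightarrow> nat) \<Rightarrow> nat \<Rightarrow> bivincular \<Rightarrow> bool" where
  "avoids n \<pi> r P \<longleftrightarrow> \<not> (\<exists>i. occurrence r P n \<pi> i)"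

definition Av :: "nat \<Rightarrow> nat \<Rightarrow> bivincular \<Rightarrow> (nat \<Rightarrow> nat) set" where
  "Av n r P = {\<pi>. \<pi> permutes {1..n} \<and> avoids n \<pi> r P}"

subsection \<open>Toric equivalence\<close>

text \<open>The circular word \<open>0 \<pi>\<^sub>1 \<dots> \<pi>\<^sub>n\<close> with \<open>m\<close> added modulo \<open>n + 1\<close> to every letter; positions are
  read modulo \<open>n + 1\<close>.\<close>

definition circ_word :: "nat \<Rightarrow> (nat \<Rightarrow> nat) \<Rightarrow> int \<Rightarrow> nat \<Rightarrow> nat" where
  "circ_word n \<pi> m k = nat ((int (\<pi> (k mod (n + 1))) + m) mod int (n + 1))"

definition zero_pos :: "nat \<Rightarrow> (nat \<Rightarrow> nat) \<Rightarrow> int \<Rightarrow> nat" where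
  "zero_pos n \<pi> m = (THE k. k \<le> n \<and> circ_word n \<pi> m k = 0)"

text \<open>The values outside \<open>{1..n}\<close> are fixed by the convention of \<open>permutes\<close>.\<close>

definition toric_shift :: "nat \<Rightarrow> (nat \<Rightarrow> nat) \<Rightarrow> int \<Rightarrow> nat \<Rightarrow> nat" where
  "toric_shift n \<pi> m i =
     (if i \<in> {1..n} then circ_word n \<pi> m (zero_pos n \<pi> m + i) else i)"

definition toric_class :: "nat \<Rightarrow> (nat \<Rightarrow> nat) \<Rightarrow> (nat \<Rightarrow> nat) set" where
  "toric_class n \<pi> = {toric_shift n \<pi> m | m. m \<in> {0..int n}}"

definition torically_equivalent :: "nat \<Rightarrow> (nat \<Rightarrow> nat) \<Rightarrow> (nat \<Rightarrow> nat) \<Rightarrow> bool" where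
  "torically_equivalent n \<pi> \<sigma> \<longleftrightarrow>
     (\<exists>\<tau>. \<tau> permutes {1..n} \<and> \<pi> \<in> toric_class n \<tau> \<and> \<sigma> \<in> toric_class n \<tau>)"

definition toric_Av :: "nat \<Rightarrow> nat \<Rightarrow> bivincular \<Rightarrow> (nat \<Rightarrow> nat) set" where
  "toric_Av n r P = {\<pi>. \<pi> permutes {1..n} \<and> avoids n \<pi> r P \<and>
     (\<forall>\<sigma>. torically_equivalent n \<pi> \<sigma> \<longrightarrow> avoids n \<sigma> r P)}"

text \<open>The position of the letter \<open>r\<close> in \<open>p\<close> is \<open>inv p r\<close>. For \<open>r = 0\<close> this is \<open>0\<close>, the position of
  the letter \<open>0\<close> in the circular word.\<close>

fun pattern_shift :: "nat \<Rightarrow> bivincular \<Rightarrow> bivincular" where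
  "pattern_shift r (p, X, Y) =
     (toric_shift r p 1,
      (\<lambda>x. nat ((int x - int (inv p r)) mod int (r + 1))) ` X,
      (\<lambda>y. (y + 1) mod (r + 1)) ` Y)"

end

theory Submission
  imports Defs "HOL-Number_Theory.Cong"
begin

text \<open>Lift everything to the integers. A permutation becomes a periodic function on all positions, and
  an occurrence becomes a pair of strictly increasing maps \<open>I\<close>, \<open>J\<close> on \<open>\<int>\<close> (positions and values) with
  \<open>I (a + (r + 1)) = I a + (n + 1)\<close>, likewise for \<open>J\<close>, and \<open>I 0 = J 0 = 0\<close>. In this form the adjacency
  conditions at the borders are like all others, and passing from \<open>\<pi>\<close> to \<open>\<pi> \<oplus> 1\<close> is just a translation
  of \<open>I\<close> and \<open>J\<close>. The only thing to check is that the origin remains fixed, and this is what \<open>r \<in> Y\<close>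
  is needed for: it says that \<open>J (- 1) = - 1\<close>.\<close>

subsection \<open>Permutations as periodic words\<close>

text \<open>The circular word \<open>0 \<pi>\<^sub>1 \<dots> \<pi>\<^sub>n\<close> unrolled to a
  bi-infinite word. It is used for the pattern as well, with \<open>r\<close> and \<open>p\<close>
  in place of \<open>n\<close> and \<open>\<pi>\<close>.\<close>

definition letter :: "nat \<Rightarrow> (nat \<Rightarrow> nat) \<Rightarrow> int \<Rightarrow> int" where
  "letter n \<pi> k = int (\<pi> (nat (k mod int (n + 1))))"

lemma cong_bounded_eq:
  fixes a b m :: int
  assumes "[a = b] (mod m)" "0 \<le> a" "a < m" "0 \<le> b" "b < m"
  shows "a = b"
  using assms by (simp add: cong_def)

lemma int_residue: "int (nat (k mod int (n + 1))) = k mod int (n + 1)"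
  by simp

lemma residue_le: "nat (k mod int (n + 1)) \<le> n"
proof -
  have "k mod int (n + 1) < int (n + 1)"
    by (rule pos_mod_bound) simp
  then show ?thesis by linarith
qed

lemma letter_of_nat: "a \<le> n \<Longrightarrow> letter n \<pi> (int a) = int (\<pi> a)"
  by (simp add: letter_def)

lemma letter_cong: "[k = l] (mod int (n + 1)) \<Longrightarrow> letter n \<pi> k = letter n \<pi> l"
  by (simp add: letter_def cong_def)

context
  fixes n :: nat and \<pi> :: "nat \<Rightarrow> nat"
  assumes perm: "\<pi> permutes {1..n}"
begin

lemma permutes_0: "\<pi> 0 = 0"
  using permutes_not_in[OF perm] by simp

lemma permutes_from_0: "\<pi> permutes {0..n}"
  using perm by (rule permutes_subset) auto

lemma letter_0: "letter n \<pi> 0 = 0"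
  by (simp add: letter_def permutes_0)

lemma letter_nonneg: "0 \<le> letter n \<pi> k"
  by (simp add: letter_def)

lemma letter_less: "letter n \<pi> k < int (n + 1)"
proof -
  have "nat (k mod int (n + 1)) \<in> {0..n}"
    using residue_le[of k n] by simp
  then have "\<pi> (nat (k mod int (n + 1))) \<in> {0..n}"
    using permutes_in_image[OF permutes_from_0] by blast
  then show ?thesis
    by (simp add: letter_def)
qed

lemma letter_eqD: "[k = l] (mod int (n + 1))" if "letter n \<pi> k = letter n \<pi> l"
proof -
  have "nat (k mod int (n + 1)) = nat (l mod int (n + 1))"
    using that permutes_inj[OF perm] by (simp add: letter_def inj_eq)
  then show ?thesis
    by (metis cong_def int_residue)
qed

text \<open>All letters are representatives in \<open>{0..n}\<close>, so congruent letters are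
  equal. Hence a position can be identified modulo \<open>n + 1\<close> from its letter modulo
  \<open>n + 1\<close>.\<close>

lemma letter_congD:
  "[letter n \<pi> k = letter n \<pi> l] (mod int (n + 1)) \<Longrightarrow> [k = l] (mod int (n + 1))"
  by (rule letter_eqD, rule cong_bounded_eq) (use letter_nonneg letter_less in auto)

lemma letter_attained: "\<exists>k\<le>n. [letter n \<pi> (int k) = c] (mod int (n + 1))"
proof -
  have "nat (c mod int (n + 1)) \<in> \<pi> ` {0..n}"
    unfolding permutes_image[OF permutes_from_0] using residue_le[of c n] by simp
  then obtain k where k: "k \<le> n" "nat (c mod int (n + 1)) = \<pi> k"
    by auto
  then have "int (\<pi> k) = c mod int (n + 1)"
    by (metis int_residue)
  with k(1) show ?thesis
    by (auto simp: letter_of_nat cong_def)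
qed

end

subsection \<open>Toric shifts\<close>

lemma circ_word_letter: "circ_word n \<pi> m k = nat ((letter n \<pi> (int k) + m) mod int (n + 1))"
  by (simp only: circ_word_def letter_def flip: zmod_int) simp

lemma circ_word_eq_0_iff:
  "circ_word n \<pi> m k = 0 \<longleftrightarrow> [letter n \<pi> (int k) = - m] (mod int (n + 1))"
proof -
  have "(letter n \<pi> (int k) + m) mod int (n + 1) \<ge> 0"
    by (rule pos_mod_sign) simp
  then have "circ_word n \<pi> m k = 0 \<longleftrightarrow> (letter n \<pi> (int k) + m) mod int (n + 1) = 0"
    unfolding circ_word_letter by linarith
  also have "\<dots> \<longleftrightarrow> [letter n \<pi> (int k) = - m] (mod int (n + 1))"
    by (simp add: cong_iff_dvd_diff mod_eq_0_iff_dvd)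
  finally show ?thesis .
qed

context
  fixes n :: nat and \<pi> :: "nat \<Rightarrow> nat"
  assumes perm: "\<pi> permutes {1..n}"
begin

text \<open>Adding \<open>m\<close> turns the letter congruent to \<open>- m\<close> into 0, and
  that letter occurs exactly once among the positions \<open>0..n\<close>. This justifies the
  definite description in \<open>zero_pos\<close>.\<close>

lemma letter_zero_pos: "[letter n \<pi> (int (zero_pos n \<pi> m)) = - m] (mod int (n + 1))"
proof -
  have "\<exists>!k. k \<le> n \<and> circ_word n \<pi> m k = 0"
  proof (rule ex_ex1I)
    show "\<exists>k. k \<le> n \<and> circ_word n \<pi> m k = 0"
      using letter_attained[OF perm] by (simp add: circ_word_eq_0_iff)
    fix k l
    assume "k \<le> n \<and> circ_word n \<pi> m k = 0" and "l \<le> n \<and> circ_word n \<pi> m l = 0"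
    then have kl: "k \<le> n" "l \<le> n" "[letter n \<pi> (int k) = - m] (mod int (n + 1))"
        "[- m = letter n \<pi> (int l)] (mod int (n + 1))"
      by (simp_all only: circ_word_eq_0_iff cong_sym_eq[of "- m"])
    have "[int k = int l] (mod int (n + 1))"
      by (rule letter_congD[OF perm cong_trans[OF kl(3,4)]])
    with kl(1,2) show "k = l"
      using cong_bounded_eq[of "int k" "int l" "int (n + 1)"] by simp
  qed
  then have "circ_word n \<pi> m (zero_pos n \<pi> m) = 0"
    unfolding zero_pos_def by (rule theI'[THEN conjunct2])
  then show ?thesis
    by (simp add: circ_word_eq_0_iff)
qed

lemma letter_toric_shift:
  "letter n (toric_shift n \<pi> m) k
    = (letter n \<pi> (k + int (zero_pos n \<pi> m)) + m) mod int (n + 1)"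
proof -
  define a where "a = nat (k mod int (n + 1))"
  have a: "int a = k mod int (n + 1)"
    unfolding a_def by (rule int_residue)
  have an: "a \<le> n"
    unfolding a_def by (rule residue_le)
  have ka: "[k = int a] (mod int (n + 1))"
    by (simp add: a cong_def)
  let ?z = "int (zero_pos n \<pi> m)"
  have "letter n (toric_shift n \<pi> m) k = int (toric_shift n \<pi> m a)"
    using letter_cong[OF ka] an by (simp add: letter_of_nat)
  also have "\<dots> = (letter n \<pi> (int a + ?z) + m) mod int (n + 1)"
  proof (cases "a = 0")
    case True
    \<comment> \<open>At position 0 the value comes from the convention outside
      \<open>{1..n}\<close>; the formula agrees because the letter at \<open>?z\<close> is
      \<open>- m\<close>.\<close>
    have "(letter n \<pi> ?z + m) mod int (n + 1) = 0"
      using letter_zero_pos[of m] by (simp add: cong_iff_dvd_diff mod_eq_0_iff_dvd)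
    then show ?thesis
      by (simp add: True toric_shift_def)
  next
    case False
    then show ?thesis
      using an by (simp add: toric_shift_def circ_word_letter add.commute)
  qed
  also have "letter n \<pi> (int a + ?z) = letter n \<pi> (k + ?z)"
    by (rule letter_cong) (intro cong_add cong_sym[OF ka] cong_refl)
  finally show ?thesis .
qed

lemma toric_shift_permutes: "toric_shift n \<pi> m permutes {1..n}"
proof (rule bij_imp_permutes)
  let ?\<sigma> = "toric_shift n \<pi> m"
  have inj: "a = b" if "?\<sigma> a = ?\<sigma> b" "a \<le> n" "b \<le> n" for a b
  proof -
    let ?z = "int (zero_pos n \<pi> m)"
    have "letter n ?\<sigma> (int a) = letter n ?\<sigma> (int b)"
      using that by (simp add: letter_of_nat)
    then have "[letter n \<pi> (int a + ?z) + m = letter n \<pi> (int b + ?z) + m] (mod int (n + 1))"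
      by (simp add: letter_toric_shift cong_def)
    then have "[int a + ?z = int b + ?z] (mod int (n + 1))"
      by (rule letter_congD[OF perm, OF iffD1[OF cong_add_rcancel]])
    then have "[int a = int b] (mod int (n + 1))"
      by (simp only: cong_add_rcancel)
    then show "a = b"
      using that cong_bounded_eq[of "int a" "int b" "int (n + 1)"] by simp
  qed
  have "?\<sigma> a \<in> {1..n}" if "a \<in> {1..n}" for a
  proof -
    have "int (?\<sigma> a) < int (n + 1)"
      using that letter_toric_shift[of m "int a"] by (simp add: letter_of_nat)
    \<comment> \<open>Injectivity holds on \<open>{0..n}\<close>, and position 0 already takes the
      value 0.\<close>
    moreover have "?\<sigma> a \<noteq> ?\<sigma> 0"
      using inj[of a 0] that by auto
    moreover have "?\<sigma> 0 = 0"
      by (simp add: toric_shift_def)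
    ultimately show ?thesis by simp
  qed
  then have "?\<sigma> ` {1..n} \<subseteq> {1..n}"
    by (rule image_subsetI)
  moreover have inj_on: "inj_on ?\<sigma> {1..n}"
    using inj by (auto intro: inj_onI)
  ultimately have "?\<sigma> ` {1..n} = {1..n}"
    by (rule endo_inj_surj[OF finite_atLeastAtMost])
  with inj_on show "bij_betw ?\<sigma> {1..n} {1..n}"
    by (rule bij_betw_imageI)
qed (auto simp: toric_shift_def)

lemma letter_toric_shift_cong:
  "[letter n (toric_shift n \<pi> m) k = letter n \<pi> (k + int (zero_pos n \<pi> m)) + m] (mod int (n + 1))"
  by (simp add: letter_toric_shift cong_def)

text \<open>The rotation \<open>c\<close> is forced: since \<open>\<sigma>\<close> has letter 0 at
  position 0, \<open>\<pi>\<close> has letter \<open>- m\<close> at \<open>c\<close>, so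
  \<open>c\<close> agrees with \<open>zero_pos n \<pi> m\<close> modulo \<open>n + 1\<close>.
  Identities between shifts can thus be proved by exhibiting any rotation, without computing
  \<open>zero_pos\<close>.\<close>

lemma toric_shift_unique:
  assumes "\<sigma> permutes {1..n}"
    and c: "\<And>k. [letter n \<sigma> k = letter n \<pi> (k + c) + m] (mod int (n + 1))"
  shows "\<sigma> = toric_shift n \<pi> m"
proof
  fix a
  let ?z = "int (zero_pos n \<pi> m)"
  have "[letter n \<pi> c = - m] (mod int (n + 1))"
    using cong_sym[OF cong_add[OF c[of 0] cong_refl[of "- m"]]] by (simp add: letter_0[OF assms(1)])
  then have "[letter n \<pi> c = letter n \<pi> ?z] (mod int (n + 1))"
    by (rule cong_trans[OF _ cong_sym[OF letter_zero_pos]])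
  then have cz: "[c = ?z] (mod int (n + 1))"
    by (rule letter_congD[OF perm])
  show "\<sigma> a = toric_shift n \<pi> m a"
  proof (cases "a \<le> n")
    case True
    have "letter n \<pi> (int a + c) = letter n \<pi> (int a + ?z)"
      by (intro letter_cong cong_add cz cong_refl)
    with c[of "int a"] have "[letter n \<sigma> (int a) = letter n \<pi> (int a + ?z) + m] (mod int (n + 1))"
      by (simp only:)
    then have "[letter n \<sigma> (int a) = letter n (toric_shift n \<pi> m) (int a)] (mod int (n + 1))"
      by (rule cong_trans[OF _ cong_sym[OF letter_toric_shift_cong]])
    then have "letter n \<sigma> (int a) = letter n (toric_shift n \<pi> m) (int a)"
      using letter_nonneg[OF assms(1)] letter_less[OF assms(1)]
        letter_nonneg[OF toric_shift_permutes] letter_less[OF toric_shift_permutes]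
      by (rule cong_bounded_eq)
    with True show ?thesis
      by (simp add: letter_of_nat)
  next
    case False
    then show ?thesis
      using permutes_not_in[OF assms(1)] by (simp add: toric_shift_def)
  qed
qed

end

section \<open>Toric shifts as an action of the integers\<close>

lemma toric_shift_0: "\<pi> permutes {1..n} \<Longrightarrow> toric_shift n \<pi> 0 = \<pi>"
  by (rule toric_shift_unique[where c = 0, symmetric]) simp_all

lemma toric_shift_add:
  assumes "\<pi> permutes {1..n}"
  shows "toric_shift n (toric_shift n \<pi> a) b = toric_shift n \<pi> (a + b)"
proof (rule toric_shift_unique[OF assms])
  let ?\<sigma> = "toric_shift n \<pi> a"
  show "toric_shift n ?\<sigma> b permutes {1..n}"
    by (intro toric_shift_permutes assms)
  fix k
  have "[letter n (toric_shift n ?\<sigma> b) k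
      = letter n ?\<sigma> (k + int (zero_pos n ?\<sigma> b)) + b] (mod int (n + 1))"
    by (intro letter_toric_shift_cong toric_shift_permutes assms)
  also have "[letter n ?\<sigma> (k + int (zero_pos n ?\<sigma> b)) + b
      = letter n \<pi> (k + int (zero_pos n ?\<sigma> b) + int (zero_pos n \<pi> a)) + a + b] (mod int (n + 1))"
    by (intro cong_add letter_toric_shift_cong assms cong_refl)
  finally show "[letter n (toric_shift n ?\<sigma> b) k
      = letter n \<pi> (k + (int (zero_pos n ?\<sigma> b) + int (zero_pos n \<pi> a))) + (a + b)] (mod int (n + 1))"
    by (simp add: add.assoc)
qed

lemma toric_shift_mod:
  assumes "\<pi> permutes {1..n}"
  shows "toric_shift n \<pi> (m mod int (n + 1)) = toric_shift n \<pi> m"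
proof (rule toric_shift_unique[OF assms])
  show "toric_shift n \<pi> (m mod int (n + 1)) permutes {1..n}"
    by (intro toric_shift_permutes assms)
  fix k
  show "[letter n (toric_shift n \<pi> (m mod int (n + 1))) k
      = letter n \<pi> (k + int (zero_pos n \<pi> (m mod int (n + 1)))) + m] (mod int (n + 1))"
    using letter_toric_shift_cong[OF assms, of "m mod int (n + 1)" k]
    by (simp add: cong_def mod_simps)
qed

text \<open>By the composition law, toric classes are orbits, so the common representative can be
  replaced by \<open>\<pi>\<close> itself; periodicity in \<open>m\<close> admits all integers as
  shifts.\<close>

lemma torically_equivalent_iff:
  assumes "\<pi> permutes {1..n}"
  shows "torically_equivalent n \<pi> \<sigma> \<longleftrightarrow> (\<exists>m. \<sigma> = toric_shift n \<pi> m)"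
proof
  assume "torically_equivalent n \<pi> \<sigma>"
  then obtain \<tau> a b where \<tau>: "\<tau> permutes {1..n}"
    and "\<pi> = toric_shift n \<tau> a" "\<sigma> = toric_shift n \<tau> b"
    by (auto simp: torically_equivalent_def toric_class_def)
  then have "\<sigma> = toric_shift n \<pi> (b - a)"
    by (simp add: toric_shift_add)
  then show "\<exists>m. \<sigma> = toric_shift n \<pi> m" ..
next
  assume "\<exists>m. \<sigma> = toric_shift n \<pi> m"
  then obtain m where "\<sigma> = toric_shift n \<pi> m" ..
  then have "\<sigma> = toric_shift n \<pi> (m mod int (n + 1))"
    by (simp only: toric_shift_mod[OF assms])
  moreover have "m mod int (n + 1) \<in> {0..int n}"
    using residue_le[of m n] by auto
  ultimately have "\<sigma> \<in> toric_class n \<pi>"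
    unfolding toric_class_def by blast
  moreover have "\<pi> \<in> toric_class n \<pi>"
    unfolding toric_class_def using toric_shift_0[OF assms, symmetric] by force
  ultimately show "torically_equivalent n \<pi> \<sigma>"
    using assms by (auto simp: torically_equivalent_def)
qed

lemma toric_Av_iff:
  "\<pi> \<in> toric_Av n r P \<longleftrightarrow> \<pi> permutes {1..n} \<and> (\<forall>m. avoids n (toric_shift n \<pi> m) r P)"
proof (cases "\<pi> permutes {1..n}")
  case True
  moreover have "avoids n \<pi> r P" if "\<forall>m. avoids n (toric_shift n \<pi> m) r P"
    using that toric_shift_0[OF True] by metis
  ultimately show ?thesis
    by (simp only: toric_Av_def mem_Collect_eq torically_equivalent_iff[OF True]) blast
qed (simp add: toric_Av_def)

subsection \<open>Lifting occurrences to the integers\<close>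

text \<open>Lifts of injections of the cycle modulo \<open>r + 1\<close> into the cycle modulo
  \<open>n + 1\<close> that preserve the cyclic order and the origin. Both border conventions are
  built in: index 0 goes to 0 and hence index \<open>r + 1\<close> to \<open>n + 1\<close>.\<close>

definition quasi_periodic :: "nat \<Rightarrow> nat \<Rightarrow> (int \<Rightarrow> int) \<Rightarrow> bool" where
  "quasi_periodic r n I \<longleftrightarrow> strict_mono I \<and> (\<forall>a. I (a + int (r + 1)) = I a + int (n + 1)) \<and> I 0 = 0"

text \<open>The congruence replaces the relative-order condition: the \<open>a\<close>-th position
  carries the value of rank \<open>p a\<close>. It is only modulo \<open>n + 1\<close> because
  \<open>J\<close> is evaluated at the reduced letter while \<open>I a\<close> may lie in any
  period.\<close>

definition lifted_occurrence ::
    "nat \<Rightarrow> bivincular \<Rightarrow> nat \<Rightarrow> (nat \<Rightarrow> nat) \<Rightarrow> (int \<Rightarrow> int) \<Rightarrow> (int \<Rightarrow> int) \<Rightarrow> bool" where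
  "lifted_occurrence r P n \<pi> I J \<longleftrightarrow> quasi_periodic r n I \<and> quasi_periodic r n J \<and>
     (\<forall>a. [letter n \<pi> (I a) = J (letter r (fst P) a)] (mod int (n + 1))) \<and>
     (\<forall>x\<in>fst (snd P). I (int x + 1) = I (int x) + 1) \<and>
     (\<forall>y\<in>snd (snd P). J (int y + 1) = J (int y) + 1)"

section \<open>Arithmetic of quasi-periodic maps\<close>

lemma quasi_periodic_mult:
  assumes "quasi_periodic r n I"
  shows "I (a + int (r + 1) * q) = I a + int (n + 1) * q"
proof -
  have step: "I (b + int (r + 1)) = I b + int (n + 1)" for b
    using assms by (simp add: quasi_periodic_def)
  show ?thesis
  proof (induction q rule: int_induct[where k = 0])
    case (step1 q)
    then show ?case
      using step[of "a + int (r + 1) * q"] by (simp add: algebra_simps)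
  next
    case (step2 q)
    then show ?case
      using step[of "a + int (r + 1) * (q - 1)"] by (simp add: algebra_simps)
  qed simp
qed

lemma quasi_periodic_cong:
  assumes "quasi_periodic r n I" and "[a = b] (mod int (r + 1))"
  shows "[I a = I b] (mod int (n + 1))"
proof -
  obtain q where "b = a + int (r + 1) * q"
    using assms(2) by (auto simp: cong_iff_lin)
  then show ?thesis
    using quasi_periodic_mult[OF assms(1), of a q] by (simp add: cong_iff_lin)
qed

text \<open>Adjacency at an index depends only on its residue modulo \<open>r + 1\<close>. This is
  why \<open>X\<close> and \<open>Y\<close> can be shifted modulo \<open>r + 1\<close>.\<close>

lemma quasi_periodic_succ_cong:
  assumes "quasi_periodic r n I" and "[a = b] (mod int (r + 1))" and "I (a + 1) = I a + 1"
  shows "I (b + 1) = I b + 1"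
proof -
  obtain q where q: "b = a + int (r + 1) * q"
    using assms(2) by (auto simp: cong_iff_lin)
  show ?thesis
    using quasi_periodic_mult[OF assms(1), of a q] quasi_periodic_mult[OF assms(1), of "a + 1" q]
      assms(3) by (simp add: q algebra_simps)
qed

lemma quasi_periodic_translate:
  assumes "quasi_periodic r n I" and "I c + d = 0"
  shows "quasi_periodic r n (\<lambda>a. I (a + c) + d)"
proof -
  have "I (a + int (r + 1) + c) = I (a + c) + int (n + 1)" for a
  proof -
    have "a + int (r + 1) + c = a + c + int (r + 1)"
      by simp
    then show ?thesis
      using assms(1) by (simp only: quasi_periodic_def)
  qed
  then show ?thesis
    using assms by (simp add: quasi_periodic_def strict_mono_def)
qed

section \<open>Extending a finite increasing sequence to all integers\<close>

definition lift :: "nat \<Rightarrow> nat \<Rightarrow> (nat \<Rightarrow> nat) \<Rightarrow> int \<Rightarrow> int" where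
  "lift r n i a = int (i (nat (a mod int (r + 1)))) + int (n + 1) * (a div int (r + 1))"

text \<open>The index \<open>r + 1\<close> opens the next period, where the lift is
  \<open>i 0\<close> plus \<open>n + 1\<close>; this is exactly the convention for
  \<open>i (r + 1)\<close>.\<close>

lemma lift_of_nat:
  assumes "i 0 = 0" "i (r + 1) = n + 1" "a \<le> r + 1"
  shows "lift r n i (int a) = int (i a)"
proof (cases "a = r + 1")
  case True
  then show ?thesis
    using assms by (simp add: lift_def)
next
  case False
  then show ?thesis
    using assms by (simp add: lift_def)
qed

text \<open>Strict growth need only be checked between consecutive indices of one period. The first
  and last steps follow from the border values, as the inner values lie strictly between 0 and
  \<open>n + 1\<close>.\<close>

lemma quasi_periodic_lift:
  assumes "i ` {1..r} \<subseteq> {1..n}" "strict_mono_on {1..r} i" "i 0 = 0" "i (r + 1) = n + 1"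
  shows "quasi_periodic r n (lift r n i)"
proof -
  have per: "lift r n i (a + int (r + 1) * q) = lift r n i a + int (n + 1) * q" for a q
    by (simp add: lift_def algebra_simps del: of_nat_add of_nat_Suc)
  have step: "i a < i (a + 1)" if "a \<le> r" for a
  proof -
    have "i a < n + 1"
      using that assms(1,3) by (cases "a = 0") (auto simp: image_subset_iff less_Suc_eq_le)
    moreover have "0 < i (a + 1)"
    proof (cases "a = r")
      case False
      then have "a + 1 \<in> {1..r}"
        using that by simp
      then have "i (a + 1) \<in> {1..n}"
        using assms(1) by blast
      then show ?thesis by simp
    qed (simp only: assms(4))
    moreover have "i a < i (a + 1)" if "0 < a" "a < r"
      using that assms(2) by (auto simp: strict_mono_on_def)
    ultimately show ?thesis
      using that assms(3,4) by (cases "a = 0"; cases "a = r") auto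
  qed
  have succ: "lift r n i a < lift r n i (a + 1)" for a
  proof -
    define b where "b = nat (a mod int (r + 1))"
    have b: "int b = a mod int (r + 1)"
      unfolding b_def by (rule int_residue)
    have br: "b \<le> r"
      unfolding b_def by (rule residue_le)
    have a: "a = int b + int (r + 1) * (a div int (r + 1))"
      unfolding b by (rule mod_mult_div_eq[symmetric])
    have "lift r n i (int b) < lift r n i (int b + 1)"
      using step[OF br] br lift_of_nat[of i r n b] lift_of_nat[of i r n "b + 1"] assms(3,4)
      by (simp add: add.commute)
    then have "lift r n i (int b + int (r + 1) * (a div int (r + 1)))
        < lift r n i (int b + 1 + int (r + 1) * (a div int (r + 1)))"
      unfolding per by simp
    moreover have "a + 1 = int b + 1 + int (r + 1) * (a div int (r + 1))"
      using a by linarith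
    ultimately show ?thesis
      by (simp only: flip: a)
  qed
  have "strict_mono (lift r n i)"
  proof (rule strict_monoI)
    fix a b :: int
    assume "a < b"
    then show "lift r n i a < lift r n i b"
      by (induction b rule: int_gr_induct) (use succ less_trans in blast)+
  qed
  moreover have "lift r n i 0 = 0"
    using assms(3) by (simp add: lift_def)
  ultimately show ?thesis
    using per[of _ 1] by (simp add: quasi_periodic_def)
qed

text \<open>A finite set has only one increasing enumeration. This pins down the existentially
  quantified \<open>j\<close> of an occurrence.\<close>

lemma strict_mono_on_image_unique:
  fixes f g :: "nat \<Rightarrow> nat"
  assumes "strict_mono_on {1..r} f" "strict_mono_on {1..r} g" "f ` {1..r} = g ` {1..r}"
    and "a \<in> {1..r}"
  shows "f a = g a"
proof -
  have sorted: "sorted_wrt (<) (map h [1..<r + 1])" if "strict_mono_on {1..r} h" for h :: "nat \<Rightarrow> nat"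
    unfolding sorted_wrt_map
    by (rule sorted_wrt_mono_rel[of _ "(<)"]) (use that in \<open>auto simp: strict_mono_on_def simp del: upt_Suc\<close>)
  have "{1..<r + 1} = {1..r}" by auto
  then have "set (map f [1..<r + 1]) = set (map g [1..<r + 1])"
    by (simp only: set_map set_upt assms(3))
  then have "map f [1..<r + 1] = map g [1..<r + 1]"
    by (rule strict_sorted_equal[OF sorted[OF assms(2)] sorted[OF assms(1)]])
  then show ?thesis
    using assms(4) by (simp del: upt_Suc)
qed

text \<open>Being ordered like \<open>p\<close> amounts to \<open>\<pi> (i a) = j (p a)\<close>,
  with \<open>j\<close> the increasing list of values. Lifting \<open>i\<close> and \<open>j\<close>
  turns this into the required congruence; conversely, \<open>I\<close> and \<open>J\<close> are
  restricted to the indices \<open>0..r + 1\<close>.\<close>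

lemma occurrence_iff_lifted:
  assumes pat: "bivincular_pattern r (p, X, Y)" and \<pi>: "\<pi> permutes {1..n}"
  shows "(\<exists>i. occurrence r (p, X, Y) n \<pi> i) \<longleftrightarrow> (\<exists>I J. lifted_occurrence r (p, X, Y) n \<pi> I J)"
proof
  have p: "p permutes {1..r}" and X: "X \<subseteq> {0..r}" and Y: "Y \<subseteq> {0..r}"
    using pat by auto
  assume "\<exists>i. occurrence r (p, X, Y) n \<pi> i"
  then obtain i j where i: "i ` {1..r} \<subseteq> {1..n}" "strict_mono_on {1..r} i" "i 0 = 0" "i (r + 1) = n + 1"
    and ord: "\<forall>a\<in>{1..r}. \<forall>b\<in>{1..r}. \<pi> (i a) < \<pi> (i b) \<longleftrightarrow> p a < p b"
    and iX: "\<forall>x\<in>X. i (x + 1) = i x + 1"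
    and jim: "j ` {1..r} = (\<lambda>a. \<pi> (i a)) ` {1..r}"
    and j: "strict_mono_on {1..r} j" "j 0 = 0" "j (r + 1) = n + 1"
    and jY: "\<forall>y\<in>Y. j (y + 1) = j y + 1"
    by auto
  have "\<pi> (i a) \<in> {1..n}" if "a \<in> {1..r}" for a
    using that i(1) permutes_in_image[OF \<pi>] by blast
  then have jn: "j ` {1..r} \<subseteq> {1..n}"
    unfolding jim by blast
  \<comment> \<open>The values of the occurrence, listed by the letters of \<open>p\<close> instead
    of by position. This list is increasing and has the same image as \<open>j\<close>, so it is
    \<open>j\<close>.\<close>
  define k where "k = (\<lambda>b. \<pi> (i (inv p b)))"
  have inv_p: "inv p b \<in> {1..r}" if "b \<in> {1..r}" for b
    using that permutes_in_image[OF permutes_inv[OF p]] by blast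
  have "strict_mono_on {1..r} k"
    using ord inv_p by (auto simp: strict_mono_on_def k_def permutes_inverses[OF p])
  moreover have "k ` {1..r} = j ` {1..r}"
  proof -
    have "k ` {1..r} = (\<lambda>a. \<pi> (i a)) ` inv p ` {1..r}"
      by (simp add: k_def image_image)
    then show ?thesis
      by (simp only: jim permutes_image[OF permutes_inv[OF p]])
  qed
  ultimately have "k b = j b" if "b \<in> {1..r}" for b
    using that j(1) strict_mono_on_image_unique by blast
  then have val: "\<pi> (i a) = j (p a)" if "a \<in> {1..r}" for a
    using that permutes_in_image[OF p, of a] by (metis k_def permutes_inverses(2)[OF p])
  \<comment> \<open>Index 0 is added, where both sides are 0, to cover every residue modulo
    \<open>r + 1\<close>.\<close>
  have val0: "\<pi> (i a) = j (p a)" if "a \<le> r" for a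
    using that val[of a] i(3) j(2) permutes_0[OF p] permutes_0[OF \<pi>] by (cases "a = 0") auto
  have I: "quasi_periodic r n (lift r n i)" and J: "quasi_periodic r n (lift r n j)"
    using quasi_periodic_lift i j jn by blast+
  have "[letter n \<pi> (lift r n i a) = lift r n j (letter r p a)] (mod int (n + 1))" for a
  proof -
    define b where "b = nat (a mod int (r + 1))"
    have b: "int b = a mod int (r + 1)"
      unfolding b_def by (rule int_residue)
    have br: "b \<le> r"
      unfolding b_def by (rule residue_le)
    have ab: "[a = int b] (mod int (r + 1))"
      by (simp add: b cong_def)
    have "letter n \<pi> (lift r n i a) = letter n \<pi> (lift r n i (int b))"
      by (rule letter_cong) (rule quasi_periodic_cong[OF I ab])
    also have "\<dots> = int (\<pi> (i b))"
    proof -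
      have "i b \<le> n"
        using br i(1,3) by (cases "b = 0") (auto simp: image_subset_iff)
      then show ?thesis
        using br i by (simp add: lift_of_nat letter_of_nat)
    qed
    also have "\<dots> = int (j (p b))"
      using val0[OF br] by simp
    also have "\<dots> = lift r n j (letter r p (int b))"
    proof -
      have "p b \<le> r"
        using br permutes_in_image[OF permutes_from_0[OF p], of b] by simp
      then show ?thesis
        using br j by (simp add: lift_of_nat letter_of_nat)
    qed
    also have "letter r p (int b) = letter r p a"
      by (rule letter_cong) (rule cong_sym[OF ab])
    finally show ?thesis by simp
  qed
  moreover have "lift r n i (int x + 1) = lift r n i (int x) + 1" if "x \<in> X" for x
    using that X iX i lift_of_nat[of i r n x] lift_of_nat[of i r n "x + 1"]
    by (auto simp: add.commute)
  moreover have "lift r n j (int y + 1) = lift r n j (int y) + 1" if "y \<in> Y" for y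
    using that Y jY j lift_of_nat[of j r n y] lift_of_nat[of j r n "y + 1"]
    by (auto simp: add.commute)
  ultimately show "\<exists>I J. lifted_occurrence r (p, X, Y) n \<pi> I J"
    using I J unfolding lifted_occurrence_def by (metis fst_conv snd_conv)
next
  have p: "p permutes {1..r}" and X: "X \<subseteq> {0..r}" and Y: "Y \<subseteq> {0..r}"
    using pat by auto
  assume "\<exists>I J. lifted_occurrence r (p, X, Y) n \<pi> I J"
  then obtain I J where I: "quasi_periodic r n I" and J: "quasi_periodic r n J"
    and val: "\<And>a. [letter n \<pi> (I a) = J (letter r p a)] (mod int (n + 1))"
    and IX: "\<And>x. x \<in> X \<Longrightarrow> I (int x + 1) = I (int x) + 1"
    and JY: "\<And>y. y \<in> Y \<Longrightarrow> J (int y + 1) = J (int y) + 1"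
    unfolding lifted_occurrence_def by auto
  \<comment> \<open>By monotonicity \<open>K\<close> is nonnegative on nonnegative indices, so
    \<open>nat\<close> loses nothing there; one period gives the border value
    \<open>n + 1\<close>.\<close>
  have restrict: "\<exists>i. (\<forall>a\<le>r + 1. int (i a) = K (int a)) \<and> i 0 = 0 \<and> i (r + 1) = n + 1
      \<and> strict_mono_on {0..r + 1} i" if K: "quasi_periodic r n K" for K
  proof -
    have mono: "strict_mono K" and K0: "K 0 = 0"
      using K by (simp_all add: quasi_periodic_def)
    have "K (0 + int (r + 1)) = K 0 + int (n + 1)"
      using K unfolding quasi_periodic_def by blast
    then have Kr: "K (int (r + 1)) = int (n + 1)"
      by (simp only: K0 add_0)
    have nn: "K (int a) \<ge> 0" for a
      using strict_mono_mono[OF mono] K0 by (metis monoD of_nat_0_le_iff)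
    have "strict_mono_on {0..r + 1} (\<lambda>a. nat (K (int a)))"
      using nn by (intro strict_mono_onI) (simp only: nat_less_eq_zless strict_mono_less[OF mono] of_nat_less_iff)
    moreover have "nat (K (int (r + 1))) = n + 1"
      by (simp only: Kr nat_int)
    ultimately show ?thesis
      using nn K0 by (intro exI[of _ "\<lambda>a. nat (K (int a))"]) simp
  qed
  obtain i where i: "\<forall>a\<le>r + 1. int (i a) = I (int a)" "i 0 = 0" "i (r + 1) = n + 1"
      "strict_mono_on {0..r + 1} i"
    using restrict[OF I] by blast
  obtain j where j: "\<forall>a\<le>r + 1. int (j a) = J (int a)" "j 0 = 0" "j (r + 1) = n + 1"
      "strict_mono_on {0..r + 1} j"
    using restrict[OF J] by blast
  have bounded: "k a \<le> n" if "strict_mono_on {0..r + 1} k" "k (r + 1) = n + 1" "a \<le> r"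
    for a and k :: "nat \<Rightarrow> nat"
    using that strict_mono_onD[OF that(1), of a "r + 1"] by simp
  have pos: "1 \<le> k a" if "strict_mono_on {0..r + 1} k" "a \<in> {1..r}" for a and k :: "nat \<Rightarrow> nat"
    using that strict_mono_onD[OF that(1), of 0 a] by simp
  have mono1: "strict_mono_on {1..r} k" if "strict_mono_on {0..r + 1} k" for k :: "nat \<Rightarrow> nat"
    using that by (auto simp: strict_mono_on_def)
  have ival: "\<pi> (i a) = j (p a)" if "a \<le> r" for a
  proof -
    have pa: "p a \<le> r"
      using that permutes_in_image[OF permutes_from_0[OF p], of a] by simp
    have ia: "i a \<le> n" and ja: "j (p a) \<le> n"
      using bounded i j that pa by blast+
    have "\<pi> (i a) \<le> n"
      using ia permutes_in_image[OF permutes_from_0[OF \<pi>], of "i a"] by simp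
    \<comment> \<open>Both sides lie in \<open>{0..n}\<close>, so the congruence will yield
      equality.\<close>
    moreover have "[int (\<pi> (i a)) = int (j (p a))] (mod int (n + 1))"
    proof -
      have "I (int a) = int (i a)" "J (int (p a)) = int (j (p a))"
        using i(1) j(1) that pa by simp_all
      then show ?thesis
        using val[of "int a"] by (simp only: letter_of_nat that pa ia)
    qed
    ultimately show ?thesis
      using ja cong_bounded_eq[of "int (\<pi> (i a))" "int (j (p a))" "int (n + 1)"] by simp
  qed
  have "i ` {1..r} \<subseteq> {1..n}"
    using bounded[OF i(4,3)] pos[OF i(4)] by auto
  moreover have "\<pi> (i a) < \<pi> (i b) \<longleftrightarrow> p a < p b" if "a \<in> {1..r}" "b \<in> {1..r}" for a b
  proof -
    have "p a \<in> {1..r}" "p b \<in> {1..r}"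
      using that permutes_in_image[OF p] by blast+
    then show ?thesis
      using that strict_mono_on_less[OF mono1[OF j(4)]] by (simp add: ival)
  qed
  moreover have "i (x + 1) = i x + 1" if "x \<in> X" for x
  proof -
    have "x \<le> r" using that X by auto
    then have "int (i (x + 1)) = int (i x + 1)"
      using i(1)[rule_format, of x] i(1)[rule_format, of "x + 1"] IX[OF that]
      by (simp add: add.commute)
    then show ?thesis by (simp only: of_nat_eq_iff)
  qed
  moreover have "j (y + 1) = j y + 1" if "y \<in> Y" for y
  proof -
    have "y \<le> r" using that Y by auto
    then have "int (j (y + 1)) = int (j y + 1)"
      using j(1)[rule_format, of y] j(1)[rule_format, of "y + 1"] JY[OF that]
      by (simp add: add.commute)
    then show ?thesis by (simp only: of_nat_eq_iff)
  qed
  moreover have "j ` {1..r} = (\<lambda>a. \<pi> (i a)) ` {1..r}"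
  proof -
    have "(\<lambda>a. \<pi> (i a)) ` {1..r} = (\<lambda>a. j (p a)) ` {1..r}"
      by (rule image_cong) (auto simp: ival)
    also have "\<dots> = j ` p ` {1..r}"
      by (simp only: image_image)
    finally show ?thesis
      by (simp only: permutes_image[OF p])
  qed
  ultimately have "occurrence r (p, X, Y) n \<pi> i"
    unfolding occurrence.simps using i(2,3) j(2,3) mono1[OF i(4)] mono1[OF j(4)]
    by (intro conjI exI[of _ j] ballI) simp_all
  then show "\<exists>i. occurrence r (p, X, Y) n \<pi> i"
    by blast
qed

subsection \<open>Shifting an occurrence\<close>

text \<open>The letter that becomes 0 under adding 1 is \<open>r\<close>, which is
  \<open>- 1\<close> modulo \<open>r + 1\<close>. So the rotation of the pattern is by the position
  of \<open>r\<close>, the amount subtracted from \<open>X\<close> in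
  \<open>pattern_shift\<close>.\<close>

lemma zero_pos_1:
  assumes "p permutes {1..r}"
  shows "[int (zero_pos r p 1) = int (inv p r)] (mod int (r + 1))"
proof (rule letter_congD[OF assms])
  have "inv p r \<le> r"
    using permutes_in_image[OF permutes_inv[OF permutes_from_0[OF assms]], of r] by simp
  then have "letter r p (int (inv p r)) = int r"
    by (simp add: letter_of_nat permutes_inverses[OF assms])
  moreover have "[int r = - 1] (mod int (r + 1))"
    by (simp add: cong_iff_dvd_diff add.commute)
  ultimately have "[letter r p (int (inv p r)) = - 1] (mod int (r + 1))"
    by simp
  then show "[letter r p (int (zero_pos r p 1)) = letter r p (int (inv p r))] (mod int (r + 1))"
    by (rule cong_trans[OF letter_zero_pos[OF assms] cong_sym])
qed

text \<open>Positions are translated by \<open>l\<close> and values by 1, and each map is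
  renormalised to fix the origin. For the positions this subtracts \<open>I l\<close>, which must
  match the rotation \<open>z\<close> of \<open>\<pi>\<close>; for the values it requires
  \<open>J (- 1) = - 1\<close>.\<close>

lemma lifted_occurrence_shift:
  assumes pat: "bivincular_pattern r (p, X, Y)" and "r \<in> Y" and \<pi>: "\<pi> permutes {1..n}"
  shows "(\<exists>I J. lifted_occurrence r (p, X, Y) n \<pi> I J) \<longleftrightarrow>
    (\<exists>I J. lifted_occurrence r (pattern_shift r (p, X, Y)) n (toric_shift n \<pi> 1) I J)"
    (is "?L \<longleftrightarrow> ?R")
proof -
  have p: "p permutes {1..r}" using pat by simp
  define l where "l = int (zero_pos r p 1)"
  define z where "z = int (zero_pos n \<pi> 1)"
  define p' where "p' = toric_shift r p 1"
  define \<pi>' where "\<pi>' = toric_shift n \<pi> 1"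
  define X' where "X' = (\<lambda>x. nat ((int x - int (inv p r)) mod int (r + 1))) ` X"
  define Y' where "Y' = (\<lambda>y. (y + 1) mod (r + 1)) ` Y"
  have shift: "pattern_shift r (p, X, Y) = (p', X', Y')"
    by (simp add: p'_def X'_def Y'_def)
  have p': "p' permutes {1..r}" and \<pi>': "\<pi>' permutes {1..n}"
    using toric_shift_permutes p \<pi> by (simp_all only: p'_def \<pi>'_def)
  have letter_p': "[letter r p' a = letter r p (a + l) + 1] (mod int (r + 1))" for a
    unfolding p'_def l_def by (rule letter_toric_shift_cong[OF p])
  have letter_\<pi>': "[letter n \<pi>' k = letter n \<pi> (k + z) + 1] (mod int (n + 1))" for k
    unfolding \<pi>'_def z_def by (rule letter_toric_shift_cong[OF \<pi>])
  have X'_eq: "[int (nat ((int x - int (inv p r)) mod int (r + 1))) = int x - l] (mod int (r + 1))"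
    for x
  proof -
    have "[int x - int (inv p r) = int x - l] (mod int (r + 1))"
      unfolding l_def by (intro cong_diff cong_refl cong_sym[OF zero_pos_1[OF p]])
    then show ?thesis
      by (simp add: cong_def)
  qed
  have Y'_eq: "[int ((y + 1) mod (r + 1)) = int y + 1] (mod int (r + 1))" for y
    by (simp add: cong_def zmod_int add.commute)
  show ?thesis
    unfolding shift \<pi>'_def[symmetric]
  proof
    assume ?L
    then obtain I J where I: "quasi_periodic r n I" and J: "quasi_periodic r n J"
      and val: "\<And>a. [letter n \<pi> (I a) = J (letter r p a)] (mod int (n + 1))"
      and IX: "\<And>x. x \<in> X \<Longrightarrow> I (int x + 1) = I (int x) + 1"
      and JY: "\<And>y. y \<in> Y \<Longrightarrow> J (int y + 1) = J (int y) + 1"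
      unfolding lifted_occurrence_def by auto
    have "[int r = - 1] (mod int (r + 1))"
      by (simp add: cong_iff_dvd_diff add.commute)
    \<comment> \<open>Adjacency at \<open>r\<close> is moved back one period to index
      \<open>- 1\<close>, giving \<open>J 0 = J (- 1) + 1\<close>.\<close>
    from quasi_periodic_succ_cong[OF J this JY[OF \<open>r \<in> Y\<close>]]
    have J_1: "J (- 1) = - 1"
      using J by (simp add: quasi_periodic_def)
    define I' where "I' = (\<lambda>a. I (a + l) + - I l)"
    define J' where "J' = (\<lambda>b. J (b + - 1) + 1)"
    have I': "quasi_periodic r n I'"
      unfolding I'_def by (rule quasi_periodic_translate[OF I]) simp
    have J': "quasi_periodic r n J'"
      unfolding J'_def by (rule quasi_periodic_translate[OF J]) (simp add: J_1)
    \<comment> \<open>At \<open>l\<close> the pattern has letter \<open>- 1\<close> modulo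
      \<open>r + 1\<close>, so the letter of \<open>\<pi>\<close> at \<open>I l\<close> is congruent
      to \<open>J (- 1) = - 1\<close>, as is the letter at \<open>z\<close>. The occurrence thus
      uses the letter that becomes 0.\<close>
    have Il: "[I l = z] (mod int (n + 1))"
    proof (rule letter_congD[OF \<pi>])
      have "[letter n \<pi> (I l) = J (letter r p l)] (mod int (n + 1))"
        by (rule val)
      also have "[J (letter r p l) = J (- 1)] (mod int (n + 1))"
        unfolding l_def by (intro quasi_periodic_cong[OF J] letter_zero_pos p)
      also have "[J (- 1) = letter n \<pi> z] (mod int (n + 1))"
        unfolding J_1 z_def by (rule cong_sym[OF letter_zero_pos[OF \<pi>]])
      finally show "[letter n \<pi> (I l) = letter n \<pi> z] (mod int (n + 1))" .
    qed
    have "[letter n \<pi>' (I' a) = J' (letter r p' a)] (mod int (n + 1))" for a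
    proof -
      have "[letter n \<pi>' (I' a) = letter n \<pi> (I' a + z) + 1] (mod int (n + 1))"
        by (rule letter_\<pi>')
      also have "letter n \<pi> (I' a + z) = letter n \<pi> (I (a + l))"
      proof (rule letter_cong)
        have "[I (a + l) - I l + z = I (a + l) - I l + I l] (mod int (n + 1))"
          by (intro cong_add cong_refl cong_sym[OF Il])
        then show "[I' a + z = I (a + l)] (mod int (n + 1))"
          by (simp add: I'_def)
      qed
      also have "[letter n \<pi> (I (a + l)) + 1 = J (letter r p (a + l)) + 1] (mod int (n + 1))"
        by (intro cong_add val cong_refl)
      also have "[J (letter r p (a + l)) + 1 = J' (letter r p' a)] (mod int (n + 1))"
      proof -
        have "[letter r p (a + l) + 1 + - 1 = letter r p' a + - 1] (mod int (r + 1))"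
          by (intro cong_add cong_sym[OF letter_p'] cong_refl)
        then have "[letter r p (a + l) = letter r p' a + - 1] (mod int (r + 1))"
          by simp
        then show ?thesis
          unfolding J'_def by (intro cong_add cong_refl quasi_periodic_cong[OF J])
      qed
      finally show ?thesis .
    qed
    moreover have "I' (int x' + 1) = I' (int x') + 1" if x': "x' \<in> X'" for x'
    proof -
      obtain x where x: "x \<in> X" "x' = nat ((int x - int (inv p r)) mod int (r + 1))"
        using x' unfolding X'_def by blast
      have "[int x - l = int x'] (mod int (r + 1))"
        unfolding x(2) by (rule cong_sym[OF X'_eq])
      then show ?thesis
        by (rule quasi_periodic_succ_cong[OF I'])
          (use IX[OF x(1)] in \<open>simp add: I'_def algebra_simps\<close>)
    qed
    moreover have "J' (int y' + 1) = J' (int y') + 1" if y': "y' \<in> Y'" for y'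
    proof -
      obtain y where y: "y \<in> Y" "y' = (y + 1) mod (r + 1)"
        using y' unfolding Y'_def by blast
      have "[int y + 1 = int y'] (mod int (r + 1))"
        unfolding y(2) by (rule cong_sym[OF Y'_eq])
      then show ?thesis
        by (rule quasi_periodic_succ_cong[OF J'])
          (use JY[OF y(1)] in \<open>simp add: J'_def algebra_simps\<close>)
    qed
    ultimately show "\<exists>I J. lifted_occurrence r (p', X', Y') n \<pi>' I J"
      using I' J' unfolding lifted_occurrence_def by (metis fst_conv snd_conv)
  next
    assume "\<exists>I J. lifted_occurrence r (p', X', Y') n \<pi>' I J"
    then obtain I' J' where I': "quasi_periodic r n I'" and J': "quasi_periodic r n J'"
      and val': "\<And>a. [letter n \<pi>' (I' a) = J' (letter r p' a)] (mod int (n + 1))"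
      and IX': "\<And>x. x \<in> X' \<Longrightarrow> I' (int x + 1) = I' (int x) + 1"
      and JY': "\<And>y. y \<in> Y' \<Longrightarrow> J' (int y + 1) = J' (int y) + 1"
      unfolding lifted_occurrence_def by auto
    \<comment> \<open>The element \<open>r\<close> of \<open>Y\<close> becomes 0 in
      \<open>Y'\<close>, so \<open>J' 1 = 1\<close>; this plays the role of
      \<open>J (- 1) = - 1\<close> in the converse.\<close>
    have "0 \<in> Y'"
      unfolding Y'_def using \<open>r \<in> Y\<close> by (rule rev_image_eqI) simp
    from JY'[OF this] have J'1: "J' 1 = 1"
      using J' by (simp add: quasi_periodic_def)
    \<comment> \<open>The inverse translations, again normalised at the origin.\<close>
    define I where "I = (\<lambda>a. I' (a + - l) + - I' (- l))"
    define J where "J = (\<lambda>b. J' (b + 1) + - 1)"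
    have I: "quasi_periodic r n I"
      unfolding I_def by (rule quasi_periodic_translate[OF I']) simp
    have J: "quasi_periodic r n J"
      unfolding J_def by (rule quasi_periodic_translate[OF J']) (simp add: J'1)
    \<comment> \<open>The letter 0 at the origin of \<open>p\<close> and of \<open>\<pi>\<close>
      becomes 1, at position \<open>- l\<close> of \<open>p'\<close> and \<open>- z\<close> of
      \<open>\<pi>'\<close>. As \<open>J' 1 = 1\<close>, the map \<open>I'\<close> matches these two
      positions.\<close>
    have I'l: "[I' (- l) = - z] (mod int (n + 1))"
    proof (rule letter_congD[OF \<pi>'])
      have "[letter n \<pi>' (I' (- l)) = J' (letter r p' (- l))] (mod int (n + 1))"
        by (rule val')
      also have "[J' (letter r p' (- l)) = J' 1] (mod int (n + 1))"
        using letter_p'[of "- l"] by (intro quasi_periodic_cong[OF J']) (simp add: letter_0[OF p])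
      also have "[J' 1 = letter n \<pi>' (- z)] (mod int (n + 1))"
        using cong_sym[OF letter_\<pi>'[of "- z"]] by (simp add: letter_0[OF \<pi>] J'1)
      finally show "[letter n \<pi>' (I' (- l)) = letter n \<pi>' (- z)] (mod int (n + 1))" .
    qed
    have "[letter n \<pi> (I a) = J (letter r p a)] (mod int (n + 1))" for a
    proof -
      have "[letter n \<pi> (I a) + 1 = letter n \<pi>' (I a - z)] (mod int (n + 1))"
        using cong_sym[OF letter_\<pi>'[of "I a - z"]] by simp
      also have "letter n \<pi>' (I a - z) = letter n \<pi>' (I' (a - l))"
      proof (rule letter_cong)
        have "[I' (a - l) - I' (- l) + - z = I' (a - l) - I' (- l) + I' (- l)] (mod int (n + 1))"
          by (intro cong_add cong_refl cong_sym[OF I'l])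
        then show "[I a - z = I' (a - l)] (mod int (n + 1))"
          by (simp add: I_def)
      qed
      also have "[letter n \<pi>' (I' (a - l)) = J' (letter r p' (a - l))] (mod int (n + 1))"
        by (rule val')
      also have "[J' (letter r p' (a - l)) = J' (letter r p a + 1)] (mod int (n + 1))"
        using letter_p'[of "a - l"] by (intro quasi_periodic_cong[OF J']) simp
      also have "J' (letter r p a + 1) = J (letter r p a) + 1"
        by (simp add: J_def)
      finally show ?thesis
        by (simp only: cong_add_rcancel)
    qed
    moreover have "I (int x + 1) = I (int x) + 1" if "x \<in> X" for x
    proof -
      have "nat ((int x - int (inv p r)) mod int (r + 1)) \<in> X'"
        using that unfolding X'_def by (rule imageI)
      from quasi_periodic_succ_cong[OF I' X'_eq IX'[OF this]]
      show ?thesis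
        by (simp add: I_def algebra_simps)
    qed
    moreover have "J (int y + 1) = J (int y) + 1" if "y \<in> Y" for y
    proof -
      have "(y + 1) mod (r + 1) \<in> Y'"
        using that unfolding Y'_def by (rule imageI)
      from quasi_periodic_succ_cong[OF J' Y'_eq JY'[OF this]]
      show ?thesis
        by (simp add: J_def)
    qed
    ultimately show ?L
      using I J unfolding lifted_occurrence_def by (metis fst_conv snd_conv)
  qed
qed

section \<open>Transfer to avoidance and toric classes\<close>

lemma bivincular_pattern_shift:
  assumes "bivincular_pattern r P"
  shows "bivincular_pattern r (pattern_shift r P)"
proof -
  obtain p X Y where P: "P = (p, X, Y)"
    by (cases P)
  have "(y + 1) mod (r + 1) \<le> r" for y
    using mod_less_divisor[of "r + 1" "y + 1"] by simp
  moreover have "nat (c mod int (r + 1)) \<le> r" for c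
    by (rule residue_le)
  ultimately show ?thesis
    using assms toric_shift_permutes[of p r 1] by (simp add: P image_subset_iff)
qed

text \<open>Occurrences on both sides are replaced by lifted ones, which correspond by translation.
  For the right-hand pattern this uses that the shift is again a bivincular pattern.\<close>

lemma avoids_shift_iff:
  assumes pat: "bivincular_pattern r (p, X, Y)" and "r \<in> Y" and \<pi>: "\<pi> permutes {1..n}"
  shows "avoids n (toric_shift n \<pi> 1) r (pattern_shift r (p, X, Y)) \<longleftrightarrow> avoids n \<pi> r (p, X, Y)"
proof -
  obtain p' X' Y' where P': "pattern_shift r (p, X, Y) = (p', X', Y')"
    by (rule prod_cases3)
  have "bivincular_pattern r (p', X', Y')"
    using bivincular_pattern_shift[OF pat] by (simp only: P')
  from occurrence_iff_lifted[OF this toric_shift_permutes[OF \<pi>, of 1]]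
  show ?thesis
    unfolding avoids_def occurrence_iff_lifted[OF pat \<pi>] lifted_occurrence_shift[OF assms] P'
    by (simp only:)
qed

theorem corollary6p8:
  fixes r n :: nat and p :: "nat \<Rightarrow> nat" and X Y :: "nat set"
  assumes "bivincular_pattern r (p, X, Y)"
    and "r \<in> Y"
  shows "bij_betw (\<lambda>\<pi>. toric_shift n \<pi> 1) (Av n r (p, X, Y)) (Av n r (pattern_shift r (p, X, Y)))
    \<and> toric_Av n r (p, X, Y) = toric_Av n r (pattern_shift r (p, X, Y))"
proof
  let ?P = "(p, X, Y)" and ?P' = "pattern_shift r (p, X, Y)"
  note shift_iff = avoids_shift_iff[OF assms]
  have inverse: "toric_shift n (toric_shift n \<pi> a) b = \<pi>"
    if "\<pi> permutes {1..n}" "a + b = 0" for \<pi> a b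
    using that by (simp add: toric_shift_add toric_shift_0)
  show "bij_betw (\<lambda>\<pi>. toric_shift n \<pi> 1) (Av n r ?P) (Av n r ?P')"
  proof (rule bij_betw_byWitness[where f' = "\<lambda>\<pi>. toric_shift n \<pi> (- 1)"])
    show "(\<lambda>\<pi>. toric_shift n \<pi> 1) ` Av n r ?P \<subseteq> Av n r ?P'"
      using toric_shift_permutes shift_iff unfolding Av_def by blast
    show "(\<lambda>\<pi>. toric_shift n \<pi> (- 1)) ` Av n r ?P' \<subseteq> Av n r ?P"
    proof (rule image_subsetI)
      fix \<pi>
      assume "\<pi> \<in> Av n r ?P'"
      then have \<pi>: "\<pi> permutes {1..n}" "avoids n \<pi> r ?P'"
        by (simp_all add: Av_def)
      \<comment> \<open>The equivalence is applied to the shift by \<open>- 1\<close>, whose shift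
        by 1 is \<open>\<pi>\<close> again.\<close>
      then show "toric_shift n \<pi> (- 1) \<in> Av n r ?P"
        using shift_iff[OF toric_shift_permutes[OF \<pi>(1), of "- 1"]] inverse[OF \<pi>(1), of "- 1" 1]
        by (simp only: Av_def mem_Collect_eq toric_shift_permutes simp_thms)
    qed
  qed (auto simp: Av_def inverse)
  have "(\<forall>m. avoids n (toric_shift n \<pi> m) r ?P) \<longleftrightarrow> (\<forall>m. avoids n (toric_shift n \<pi> m) r ?P')"
    if \<pi>: "\<pi> permutes {1..n}" for \<pi>
  proof -
    \<comment> \<open>Every member of the toric class is moved to the next one; as \<open>m\<close>
      runs over all integers, so does \<open>m + 1\<close>.\<close>
    have "avoids n (toric_shift n \<pi> m) r ?P \<longleftrightarrow> avoids n (toric_shift n \<pi> (m + 1)) r ?P'" for m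
      using shift_iff[OF toric_shift_permutes[OF \<pi>, of m]] by (simp only: toric_shift_add[OF \<pi>])
    then show ?thesis
      by (metis diff_add_cancel)
  qed
  then show "toric_Av n r ?P = toric_Av n r ?P'"
    by (auto simp only: toric_Av_iff)
qed

end
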